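(* Let $d\ge 1$ and let $\lambda,\mu$ be partitions of $d$. Then $p_\lambda(x)\ge p_\mu(x)$ for all $x\in\mathbb{R}_{\ge 0}^n$ and all positive integers $n$ if and only if $\lambda\succeq\mu$ in the superdominance order.
   Context: For a positive integer $r$, $p_r(X_1,\dots,X_n)=X_1^r+\cdots+X_n^r$, and for a partition $\lambda=(\lambda_1\ge\cdots\ge\lambda_{\ell(\lambda)})$ with $\ell(\lambda)$ (positive) parts, $p_\lambda=\prod_{i=1}^{\ell(\lambda)}p_{\lambda_i}$. Write $\lambda_{(1)}\le\lambda_{(2)}\le\cdots\le\lambda_{(\ell(\lambda))}$ for the parts of $\lambda$ in increasing order. Superdominance order: for partitions $\lambda,\mu$ of the same integer $d$, $\lambda\succeq\mu$ means $\sum_{i=1}^{j}\lambda_{(i)}\le\sum_{i=1}^{j}\mu_{(i)}$ for each $j=1,\dots,\min\{\ell(\lambda),\ell(\mu)\}$. *)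

theory Defs
  imports Complex_Main
begin

definition is_partition :: "nat \<Rightarrow> nat list \<Rightarrow> bool" where
  "is_partition d lam \<longleftrightarrow> sorted_wrt (\<ge>) lam \<and> (\<forall>k \<in> set lam. k > 0) \<and> sum_list lam = d"

(* A point of R^n is a function x whose values x 1, ..., x n are the coordinates; values of x
   at other indices are irrelevant. Power sums are given through their evaluations. *)
definition nonneg_orthant :: "nat \<Rightarrow> (nat \<Rightarrow> real) set" where
  "nonneg_orthant n = {x. \<forall>i \<in> {1..n}. x i \<ge> 0}"

definition power_sum :: "nat \<Rightarrow> nat \<Rightarrow> (nat \<Rightarrow> real) \<Rightarrow> real" where
  "power_sum n r x = (\<Sum>i = 1..n. x i ^ r)"

definition power_sum_partition :: "nat \<Rightarrow> nat list \<Rightarrow> (nat \<Rightarrow> real) \<Rightarrow> real" where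
  "power_sum_partition n lam x = (\<Prod>k \<leftarrow> lam. power_sum n k x)"

(* The i-th smallest part, counted from i = 1 and only meaningful for i up to length of the
   partition; list indexing in HOL is 0-based. *)
definition increasing_part :: "nat list \<Rightarrow> nat \<Rightarrow> nat" where
  "increasing_part lam i = sort lam ! (i - 1)"

(* The order proper relates partitions of the same integer; this is the inequality condition. *)
definition superdominates :: "nat list \<Rightarrow> nat list \<Rightarrow> bool" (infix "\<succeq>" 50) where
  "lam \<succeq> mu \<longleftrightarrow>
     (\<forall>j \<in> {1..min (length lam) (length mu)}.
        (\<Sum>i = 1..j. increasing_part lam i) \<le> (\<Sum>i = 1..j. increasing_part mu i))"

end

theory Submission
  imports Defs "HOL-Library.Multiset"
begin

text \<open>For a nonzero point of the nonnegative orthant, \<open>ln (p\<^sub>r)\<close> is a convex function of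
  \<open>r\<close> by Cauchy-Schwarz, and superdominance is majorization once the largest parts of \<open>\<lambda>\<close> have been
  merged so that both partitions have the same length (merging decreases \<open>p\<^sub>\<lambda>\<close>). Hence
  sufficiency is an instance of Karamata's inequality.

  For necessity, evaluate at one coordinate \<open>1\<close> and \<open>N ^ k\<close> coordinates \<open>1 / N\<close>. Up to
  bounded factors \<open>p\<^sub>\<lambda>\<close> is then \<open>N\<close> to the power of the sum of all \<open>max 0 (k - \<lambda>\<^sub>i)\<close>, so letting
  \<open>N\<close> grow compares these exponents; choosing \<open>k\<close> to be the \<open>j\<close>-th smallest part of \<open>\<lambda>\<close> yields the
  \<open>j\<close>-th inequality of the order.\<close>

section \<open>Superdominance as a comparison of prefix sums of sorted lists\<close>

lemma sum_list_map_sort: "sum_list (map f (sort xs)) = sum_list (map f xs)"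
  for f :: "'a::linorder \<Rightarrow> 'b::comm_monoid_add"
  by (metis mset_map mset_sort sum_mset_sum_list)

lemma prod_list_map_sort: "prod_list (map f (sort xs)) = prod_list (map f xs)"
  for f :: "'a::linorder \<Rightarrow> 'b::comm_monoid_mult"
  by (metis mset_map mset_sort prod_mset_prod_list)

lemma sum_increasing_part:
  assumes "j \<le> length lam"
  shows "(\<Sum>i = 1..j. increasing_part lam i) = sum_list (take j (sort lam))"
proof -
  have "(\<Sum>i = 1..j. increasing_part lam i) = (\<Sum>i = 0..<j. sort lam ! i)"
    unfolding increasing_part_def
    by (rule sum.reindex_bij_witness[where i = Suc and j = "\<lambda>i. i - 1"]) auto
  also have "\<dots> = sum_list (take j (sort lam))"
    using assms by (simp add: sum_list_sum_nth)
  finally show ?thesis .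
qed

lemma superdominates_iff_sum_list_take:
  "lam \<succeq> mu \<longleftrightarrow> (\<forall>j \<le> min (length lam) (length mu).
     sum_list (take j (sort lam)) \<le> sum_list (take j (sort mu)))"
proof -
  have "lam \<succeq> mu \<longleftrightarrow> (\<forall>j \<in> {1..min (length lam) (length mu)}.
     sum_list (take j (sort lam)) \<le> sum_list (take j (sort mu)))"
    unfolding superdominates_def
    by (intro ball_cong refl) (simp add: sum_increasing_part del: One_nat_def)
  also have "\<dots> \<longleftrightarrow> (\<forall>j \<le> min (length lam) (length mu).
     sum_list (take j (sort lam)) \<le> sum_list (take j (sort mu)))"
    by (metis atLeastAtMost_iff less_one not_le order_refl take0)
  finally show ?thesis .
qed

subsection \<open>Karamata's inequality for convex sequences\<close>

text \<open>Telescope \<open>f\<close> between \<open>b\<close> and \<open>a\<close>: differences to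
  the right of \<open>b\<close> are at least the one at \<open>b\<close>, those to the left at most.
  The cases induct upwards and downwards from \<open>b\<close>.\<close>

lemma convex_seq_above_tangent:
  fixes f :: "nat \<Rightarrow> real"
  assumes mono: "mono (\<lambda>r. f (Suc r) - f r)"
  shows "(f (Suc b) - f b) * (real a - real b) \<le> f a - f b"
proof (cases "b \<le> a")
  case True
  then show ?thesis
  proof (induction a rule: dec_induct)
    case (step a)
    have "f (Suc b) - f b \<le> f (Suc a) - f a"
      using monoD[OF mono] step.hyps by auto
    with step.IH show ?case by (simp add: algebra_simps)
  qed simp
next
  case False
  then have "a \<le> b" by simp
  then show ?thesis
  proof (induction a rule: inc_induct)
    case (step a)
    have "f (Suc a) - f a \<le> f (Suc b) - f b"
      using monoD[OF mono, of a b] step.hyps by auto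
    with step.IH show ?case by (simp add: algebra_simps)
  qed simp
qed

text \<open>Abel summation, done by induction: raising the weight of a nonpositive prefix sum of
  \<open>h\<close> from \<open>g m\<close> to \<open>g (Suc m)\<close> can only decrease the
  product. The full sum up to \<open>m\<close> may have any sign.\<close>

lemma sum_mult_mono_ge:
  fixes g h :: "nat \<Rightarrow> real"
  assumes "\<And>i j. i \<le> j \<Longrightarrow> j \<le> m \<Longrightarrow> g i \<le> g j"
    and "\<And>j. j \<le> m \<Longrightarrow> (\<Sum>i<j. h i) \<le> 0"
  shows "g m * (\<Sum>i<Suc m. h i) \<le> (\<Sum>i<Suc m. g i * h i)"
  using assms
proof (induction m)
  case (Suc m)
  have "g (Suc m) * (\<Sum>i<Suc m. h i) \<le> g m * (\<Sum>i<Suc m. h i)"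
    using Suc.prems(1)[of m "Suc m"] Suc.prems(2)[of "Suc m"] by (intro mult_right_mono_neg) auto
  also have "\<dots> \<le> (\<Sum>i<Suc m. g i * h i)"
    by (rule Suc.IH) (use Suc.prems in auto)
  finally show ?case by (simp add: algebra_simps)
qed simp

text \<open>Bound each \<open>f (xs ! i) - f (ys ! i)\<close> below by the tangent at
  \<open>ys ! i\<close>. Since \<open>ys\<close> is sorted, the slopes increase with
  \<open>i\<close>, so partial summation applies to the tangent terms.\<close>

lemma Karamata_seq:
  fixes f :: "nat \<Rightarrow> real" and xs ys :: "nat list"
  assumes mono: "mono (\<lambda>r. f (Suc r) - f r)"
    and len: "length xs = length ys" and ys: "sorted ys"
    and total: "sum_list xs = sum_list ys"
    and take: "\<And>j. j < length ys \<Longrightarrow> sum_list (take j xs) \<le> sum_list (take j ys)"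
  shows "sum_list (map f ys) \<le> sum_list (map f xs)"
proof (cases "length ys")
  case 0
  then show ?thesis using len by simp
next
  case (Suc m)
  define g where "g i = f (Suc (ys ! i)) - f (ys ! i)" for i
  define h where "h i = real (xs ! i) - real (ys ! i)" for i
  have prefix: "(\<Sum>i<j. h i) = real (sum_list (take j xs)) - real (sum_list (take j ys))"
    if "j \<le> length ys" for j
    using that len
    by (simp add: h_def sum_subtractf sum_list_sum_nth atLeast0LessThan)
  \<comment> \<open>Equal totals make the boundary term of the partial summation vanish.\<close>
  have "0 = g m * (\<Sum>i<Suc m. h i)"
    using prefix[of "Suc m"] total len Suc by simp
  also have "\<dots> \<le> (\<Sum>i<Suc m. g i * h i)"
  proof (rule sum_mult_mono_ge)
    show "g i \<le> g j" if "i \<le> j" "j \<le> m" for i j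
      using monoD[OF mono] sorted_nth_mono[OF ys, of i j] that Suc by (auto simp: g_def)
    show "(\<Sum>i<j. h i) \<le> 0" if "j \<le> m" for j
      using prefix[of j] take[of j] that Suc by simp
  qed
  also have "\<dots> \<le> (\<Sum>i<Suc m. f (xs ! i) - f (ys ! i))"
    unfolding g_def h_def by (intro sum_mono convex_seq_above_tangent mono)
  finally show ?thesis
    using len Suc by (simp add: sum_subtractf sum_list_sum_nth atLeast0LessThan)
qed

subsection \<open>Power sums on the nonnegative orthant\<close>

lemma power_sum_nonneg: "x \<in> nonneg_orthant n \<Longrightarrow> 0 \<le> power_sum n r x"
  by (auto simp: power_sum_def nonneg_orthant_def intro!: sum_nonneg)

lemma power_sum_pos:
  assumes "x \<in> nonneg_orthant n" "i \<in> {1..n}" "x i \<noteq> 0"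
  shows "0 < power_sum n r x"
proof -
  have "0 < x i" using assms by (force simp: nonneg_orthant_def)
  then show ?thesis
    unfolding power_sum_def
    by (intro sum_pos2[OF _ assms(2)]) (use assms in \<open>auto simp: nonneg_orthant_def\<close>)
qed

lemma power_sum_add_le:
  assumes "x \<in> nonneg_orthant n"
  shows "power_sum n (a + b) x \<le> power_sum n a x * power_sum n b x"
proof -
  have "(\<Sum>i = 1..n. x i ^ a * x i ^ b) \<le> (\<Sum>i = 1..n. x i ^ a * power_sum n b x)"
    unfolding power_sum_def using assms
    by (intro sum_mono mult_left_mono member_le_sum) (auto simp: nonneg_orthant_def)
  then show ?thesis by (simp add: power_sum_def power_add sum_distrib_right)
qed

text \<open>Used to merge parts. The empty list must be excluded: the power sum of exponent 0 is
  \<open>n\<close>, while the empty product is 1.\<close>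

lemma power_sum_sum_list_le:
  assumes "x \<in> nonneg_orthant n" "xs \<noteq> []"
  shows "power_sum n (sum_list xs) x \<le> power_sum_partition n xs x"
  using assms(2)
proof (induction xs rule: list_nonempty_induct)
  case (cons k xs)
  have "power_sum n (k + sum_list xs) x \<le> power_sum n k x * power_sum n (sum_list xs) x"
    by (rule power_sum_add_le[OF assms(1)])
  also have "\<dots> \<le> power_sum n k x * power_sum_partition n xs x"
    by (intro mult_left_mono cons.IH power_sum_nonneg assms(1))
  finally show ?case by (simp add: power_sum_partition_def)
qed (simp add: power_sum_partition_def)

text \<open>Cauchy-Schwarz, obtained by expanding the nonnegative sum of
  \<open>x\<^sub>i ^ r * (p\<^sub>r * x\<^sub>i - p\<^sub>r\<^sub>+\<^sub>1)\<^sup>2\<close>.\<close>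

lemma power_sum_log_convex:
  assumes x: "x \<in> nonneg_orthant n" and pos: "0 < power_sum n r x"
  shows "(power_sum n (Suc r) x)\<^sup>2 \<le> power_sum n r x * power_sum n (Suc (Suc r)) x"
proof -
  let ?p = "\<lambda>r. power_sum n r x"
  have "0 \<le> (\<Sum>i = 1..n. x i ^ r * (?p r * x i - ?p (Suc r))\<^sup>2)"
    using x by (intro sum_nonneg) (auto simp: nonneg_orthant_def)
  also have "\<dots> = (\<Sum>i = 1..n. (?p r)\<^sup>2 * x i ^ Suc (Suc r)
      - 2 * ?p r * ?p (Suc r) * x i ^ Suc r + (?p (Suc r))\<^sup>2 * x i ^ r)"
    by (intro sum.cong refl) (simp add: power2_eq_square algebra_simps)
  also have "\<dots> = (?p r)\<^sup>2 * ?p (Suc (Suc r)) - 2 * ?p r * ?p (Suc r) * ?p (Suc r)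
      + (?p (Suc r))\<^sup>2 * ?p r"
    unfolding sum.distrib sum_subtractf sum_distrib_left[symmetric] power_sum_def[symmetric] ..
  also have "\<dots> = ?p r * (?p r * ?p (Suc (Suc r)) - (?p (Suc r))\<^sup>2)"
    by (simp add: power2_eq_square algebra_simps)
  finally show ?thesis using pos by (simp add: zero_le_mult_iff)
qed

lemma mono_ln_power_sum_diff:
  assumes x: "x \<in> nonneg_orthant n" and pos: "\<And>r. 0 < power_sum n r x"
  shows "mono (\<lambda>r. ln (power_sum n (Suc r) x) - ln (power_sum n r x))"
proof (rule incseq_SucI)
  fix r
  have "ln ((power_sum n (Suc r) x)\<^sup>2) \<le> ln (power_sum n r x * power_sum n (Suc (Suc r)) x)"
    using power_sum_log_convex[OF x pos, of r] pos[of "Suc r"] by (intro ln_mono) auto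
  then show "ln (power_sum n (Suc r) x) - ln (power_sum n r x)
      \<le> ln (power_sum n (Suc (Suc r)) x) - ln (power_sum n (Suc r) x)"
    using pos by (simp add: ln_mult_pos ln_realpow)
qed

lemma power_sum_partition_pos:
  "(\<And>r. 0 < power_sum n r x) \<Longrightarrow> 0 < power_sum_partition n xs x"
  by (induction xs) (auto simp: power_sum_partition_def)

lemma ln_power_sum_partition:
  assumes pos: "\<And>r. 0 < power_sum n r x"
  shows "ln (power_sum_partition n xs x) = (\<Sum>k \<leftarrow> xs. ln (power_sum n k x))"
proof (induction xs)
  case (Cons k xs)
  then show ?case
    using power_sum_partition_pos[OF pos, of xs] pos[of k]
    by (simp add: power_sum_partition_def ln_mult_pos)
qed (simp add: power_sum_partition_def)

subsection \<open>Sufficiency\<close>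

text \<open>If \<open>mu\<close> were longer, the inequality at \<open>j = length lam\<close> would
  bound the whole sum of \<open>lam\<close> by a prefix of \<open>mu\<close> that omits positive
  parts.\<close>

lemma superdominates_length_le:
  assumes dom: "lam \<succeq> mu" and eq: "sum_list lam = sum_list mu" and pos: "\<forall>k \<in> set mu. k > 0"
  shows "length mu \<le> length lam"
proof (rule ccontr)
  assume less: "\<not> length mu \<le> length lam"
  let ?L = "length lam"
  have "sum_list lam = sum_list (sort lam)"
    using sum_list_map_sort[of id lam] by simp
  also have "\<dots> = sum_list (take ?L (sort lam))" by simp
  also have "\<dots> \<le> sum_list (take ?L (sort mu))"
    using dom[unfolded superdominates_iff_sum_list_take, rule_format, of ?L] less by simp
  also have "\<dots> < sum_list (take ?L (sort mu)) + sum_list (drop ?L (sort mu))"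
  proof -
    obtain k ks where ks: "drop ?L (sort mu) = k # ks"
      using less by (cases "drop ?L (sort mu)") auto
    then have "k \<in> set (sort mu)" by (metis in_set_dropD list.set_intros(1))
    then show ?thesis using pos ks by simp
  qed
  also have "\<dots> = sum_list (sort mu)"
    by (metis append_take_drop_id sum_list_append)
  also have "\<dots> = sum_list mu"
    using sum_list_map_sort[of id mu] by simp
  finally show False using eq by simp
qed

lemma power_sum_partition_le_if_superdominates:
  assumes dom: "lam \<succeq> mu" and eq: "sum_list lam = sum_list mu"
    and mu_pos: "\<forall>k \<in> set mu. k > 0" and "lam \<noteq> []" "mu \<noteq> []"
    and x: "x \<in> nonneg_orthant n"
  shows "power_sum_partition n mu x \<le> power_sum_partition n lam x"
proof (cases "\<exists>i \<in> {1..n}. x i \<noteq> 0")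
  case False
  obtain k ks where mu: "mu = k # ks" using \<open>mu \<noteq> []\<close> by (cases mu) auto
  then have "power_sum n k x = 0"
    using False mu_pos by (auto simp: power_sum_def intro!: sum.neutral)
  then have "power_sum_partition n mu x = 0" using mu by (simp add: power_sum_partition_def)
  also have "\<dots> \<le> power_sum_partition n lam x"
    unfolding power_sum_partition_def
    by (intro prod_list_nonneg) (auto intro: power_sum_nonneg[OF x])
  finally show ?thesis .
next
  case True
  then have pos: "0 < power_sum n r x" for r using power_sum_pos[OF x] by blast
  define m where "m = length mu - 1"
  have len: "length mu = Suc m" using \<open>mu \<noteq> []\<close> by (simp add: m_def)
  have lenle: "Suc m \<le> length lam"
    using superdominates_length_le[OF dom eq mu_pos] len by simp
  let ?as = "sort lam" and ?bs = "sort mu"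
  \<comment> \<open>Keep the \<open>m\<close> smallest parts of \<open>lam\<close> and merge the
    others into one, so that \<open>cs\<close> has as many entries as \<open>mu\<close>.\<close>
  define cs where "cs = take m ?as @ [sum_list (drop m ?as)]"
  have sum_cs: "sum_list cs = sum_list ?as"
    unfolding cs_def by (metis append_take_drop_id sum_list.Cons sum_list.Nil sum_list_append add_0_right)
  have "(\<Sum>k \<leftarrow> ?bs. ln (power_sum n k x)) \<le> (\<Sum>k \<leftarrow> cs. ln (power_sum n k x))"
  proof (rule Karamata_seq)
    show "mono (\<lambda>r. ln (power_sum n (Suc r) x) - ln (power_sum n r x))"
      by (rule mono_ln_power_sum_diff[OF x pos])
    show "length cs = length ?bs" using len lenle by (simp add: cs_def)
    show "sum_list cs = sum_list ?bs"
      using sum_cs eq sum_list_map_sort[of id lam] sum_list_map_sort[of id mu] by simp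
    show "sum_list (take j cs) \<le> sum_list (take j ?bs)" if "j < length ?bs" for j
    proof -
      \<comment> \<open>Here \<open>j \<le> m\<close>, so the prefix stops before the merged
        part.\<close>
      have "take j cs = take j ?as" using that len lenle by (simp add: cs_def min_def)
      then show ?thesis
        using dom that len lenle unfolding superdominates_iff_sum_list_take by simp
    qed
  qed simp
  then have "power_sum_partition n ?bs x \<le> power_sum_partition n cs x"
    using power_sum_partition_pos[OF pos] by (simp add: ln_power_sum_partition[OF pos, symmetric])
  also have "\<dots> = power_sum_partition n (take m ?as) x * power_sum n (sum_list (drop m ?as)) x"
    by (simp add: cs_def power_sum_partition_def)
  \<comment> \<open>Undo the merging; \<open>lenle\<close> ensures that the merged block is
    nonempty.\<close>
  also have "\<dots> \<le> power_sum_partition n (take m ?as) x * power_sum_partition n (drop m ?as) x"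
    using lenle power_sum_partition_pos[OF pos]
    by (intro mult_left_mono power_sum_sum_list_le[OF x]) (auto intro: less_imp_le)
  also have "\<dots> = power_sum_partition n ?as x"
    unfolding power_sum_partition_def
    by (metis append_take_drop_id map_append prod_list.append)
  finally show ?thesis by (simp add: power_sum_partition_def prod_list_map_sort)
qed

subsection \<open>Necessity\<close>

text \<open>The parameter \<open>k\<close> enters only through the dimension
  \<open>Suc (N ^ k)\<close>.\<close>

definition test_point :: "nat \<Rightarrow> nat \<Rightarrow> real" where
  "test_point N i = (if i = 1 then 1 else 1 / real N)"

lemma test_point_in_nonneg_orthant: "test_point N \<in> nonneg_orthant n"
  by (simp add: test_point_def nonneg_orthant_def)

lemma power_sum_test_point:
  "power_sum (Suc (N ^ k)) r (test_point N) = 1 + real N ^ k / real N ^ r"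
proof -
  have "power_sum (Suc (N ^ k)) r (test_point N)
      = 1 + (\<Sum>i = Suc 1..Suc (N ^ k). test_point N i ^ r)"
    unfolding power_sum_def by (subst sum.atLeast_Suc_atMost) (auto simp: test_point_def)
  also have "(\<Sum>i = Suc 1..Suc (N ^ k). test_point N i ^ r)
      = (\<Sum>i = Suc 1..Suc (N ^ k). (1 / real N) ^ r)"
    by (intro sum.cong) (auto simp: test_point_def)
  finally show ?thesis by (simp add: power_one_over)
qed

text \<open>Truncated subtraction makes \<open>N ^ (k - r)\<close> equal to \<open>1\<close> for \<open>r \<ge> k\<close>.\<close>

lemma power_sum_test_point_bounds:
  assumes "N \<ge> 1"
  shows "real N ^ (k - r) \<le> power_sum (Suc (N ^ k)) r (test_point N)"
    and "power_sum (Suc (N ^ k)) r (test_point N) \<le> 2 * real N ^ (k - r)"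
proof -
  show "real N ^ (k - r) \<le> power_sum (Suc (N ^ k)) r (test_point N)"
    using assms by (cases "r \<le> k") (simp_all add: power_sum_test_point power_diff)
  have "real N ^ k / real N ^ r \<le> 1" if "k \<le> r"
    using assms that by (simp add: divide_le_eq_1 power_increasing)
  moreover have "real N ^ k / real N ^ r = real N ^ (k - r)" if "r \<le> k"
    using assms that by (simp add: power_diff)
  moreover have "1 \<le> real N ^ (k - r)" using assms by simp
  ultimately show "power_sum (Suc (N ^ k)) r (test_point N) \<le> 2 * real N ^ (k - r)"
    by (cases "r \<le> k") (auto simp: power_sum_test_point)
qed

lemma power_sum_partition_test_point_ge:
  assumes "N \<ge> 1"
  shows "real N ^ (\<Sum>r \<leftarrow> xs. k - r) \<le> power_sum_partition (Suc (N ^ k)) xs (test_point N)"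
proof (induction xs)
  case (Cons r xs)
  then have "real N ^ (k - r) * real N ^ (\<Sum>r \<leftarrow> xs. k - r)
      \<le> power_sum (Suc (N ^ k)) r (test_point N)
        * power_sum_partition (Suc (N ^ k)) xs (test_point N)"
    by (intro mult_mono power_sum_test_point_bounds assms power_sum_nonneg
        test_point_in_nonneg_orthant) auto
  then show ?case by (simp add: power_sum_partition_def power_add)
qed (simp add: power_sum_partition_def)

lemma power_sum_partition_test_point_le:
  assumes "N \<ge> 1"
  shows "power_sum_partition (Suc (N ^ k)) xs (test_point N)
    \<le> 2 ^ length xs * real N ^ (\<Sum>r \<leftarrow> xs. k - r)"
proof (induction xs)
  case (Cons r xs)
  have "0 \<le> power_sum_partition (Suc (N ^ k)) xs (test_point N)"
    using power_sum_partition_test_point_ge[OF assms] order_trans zero_le_power of_nat_0_le_iff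
    by meson
  with Cons have "power_sum (Suc (N ^ k)) r (test_point N)
        * power_sum_partition (Suc (N ^ k)) xs (test_point N)
      \<le> (2 * real N ^ (k - r)) * (2 ^ length xs * real N ^ (\<Sum>r \<leftarrow> xs. k - r))"
    by (intro mult_mono power_sum_test_point_bounds assms) auto
  then show ?case by (simp add: power_sum_partition_def power_add mult_ac)
qed (simp add: power_sum_partition_def)

lemma sum_list_diff_le_if_power_sum_partition_le:
  assumes "\<And>N. power_sum_partition (Suc (N ^ k)) mu (test_point N)
    \<le> power_sum_partition (Suc (N ^ k)) lam (test_point N)"
  shows "(\<Sum>r \<leftarrow> mu. k - r) \<le> (\<Sum>r \<leftarrow> lam. k - r)"
proof (rule ccontr)
  define s where "s = (\<Sum>r \<leftarrow> lam. k - r)"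
  assume "\<not> (\<Sum>r \<leftarrow> mu. k - r) \<le> (\<Sum>r \<leftarrow> lam. k - r)"
  then have less: "Suc s \<le> (\<Sum>r \<leftarrow> mu. k - r)" by (simp add: s_def)
  \<comment> \<open>Just above the constant in the upper bound for \<open>lam\<close>, so one
    surplus factor \<open>N\<close> on the side of \<open>mu\<close> is a contradiction.\<close>
  define N :: nat where "N = Suc (2 ^ length lam)"
  have N: "N \<ge> 1" by (simp add: N_def)
  have "real N ^ Suc s \<le> real N ^ (\<Sum>r \<leftarrow> mu. k - r)"
    using less N by (intro power_increasing) auto
  also have "\<dots> \<le> power_sum_partition (Suc (N ^ k)) mu (test_point N)"
    by (rule power_sum_partition_test_point_ge[OF N])
  also have "\<dots> \<le> power_sum_partition (Suc (N ^ k)) lam (test_point N)"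
    by (rule assms)
  also have "\<dots> \<le> 2 ^ length lam * real N ^ s"
    unfolding s_def by (rule power_sum_partition_test_point_le[OF N])
  finally have "real N \<le> 2 ^ length lam" using N by simp
  then show False by (simp add: N_def)
qed

text \<open>With truncated subtraction, \<open>(k - r) + r\<close> is the maximum of
  \<open>k\<close> and \<open>r\<close>; equality below holds once all entries are at most
  \<open>k\<close>.\<close>

lemma sum_list_diff_add_sum_list_ge:
  fixes xs :: "nat list"
  shows "length xs * k \<le> (\<Sum>r \<leftarrow> xs. k - r) + sum_list xs"
  by (induction xs) auto

lemma sum_list_diff_add_sum_list_eq:
  fixes xs :: "nat list"
  assumes "\<forall>r \<in> set xs. r \<le> k"
  shows "(\<Sum>r \<leftarrow> xs. k - r) + sum_list xs = length xs * k"
  using assms by (induction xs) auto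

lemma superdominates_if_sum_list_diff_le:
  assumes le: "\<And>k. (\<Sum>r \<leftarrow> mu. k - r) \<le> (\<Sum>r \<leftarrow> lam. k - r)"
  shows "lam \<succeq> mu"
  unfolding superdominates_iff_sum_list_take
proof (intro allI impI)
  fix j assume j: "j \<le> min (length lam) (length mu)"
  show "sum_list (take j (sort lam)) \<le> sum_list (take j (sort mu))"
  proof (cases j)
    case (Suc i)
    let ?as = "sort lam" and ?bs = "sort mu"
    \<comment> \<open>As \<open>j = Suc i\<close>, this is the \<open>j\<close>-th smallest part of
      \<open>lam\<close>: truncation is exact on the first \<open>j\<close> parts and gives 0 on the
      others.\<close>
    define k where "k = ?as ! i"
    have small: "r \<le> k" if "r \<in> set (take j ?as)" for r
      using that j Suc by (auto simp: k_def in_set_conv_nth intro!: sorted_nth_mono)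
    have large: "k \<le> r" if "r \<in> set (drop j ?as)" for r
      using that j Suc by (auto simp: k_def in_set_conv_nth intro!: sorted_nth_mono)
    have split: "(\<Sum>r \<leftarrow> xs. k - r) = (\<Sum>r \<leftarrow> take j xs. k - r) + (\<Sum>r \<leftarrow> drop j xs. k - r)"
      for xs :: "nat list"
      by (metis append_take_drop_id map_append sum_list_append)
    have "j * k \<le> (\<Sum>r \<leftarrow> take j ?bs. k - r) + sum_list (take j ?bs)"
      using sum_list_diff_add_sum_list_ge[of "take j ?bs" k] j by simp
    \<comment> \<open>For \<open>mu\<close> the position of \<open>k\<close> is unknown, but the
      added terms are nonnegative.\<close>
    also have "(\<Sum>r \<leftarrow> take j ?bs. k - r) \<le> (\<Sum>r \<leftarrow> ?bs. k - r)"
      using split[of ?bs] by simp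
    also have "\<dots> \<le> (\<Sum>r \<leftarrow> ?as. k - r)"
      using le by (simp add: sum_list_map_sort)
    also have "\<dots> = (\<Sum>r \<leftarrow> take j ?as. k - r)"
      using split[of ?as] large by simp
    finally have "j * k \<le> (\<Sum>r \<leftarrow> take j ?as. k - r) + sum_list (take j ?bs)"
      by simp
    moreover have "(\<Sum>r \<leftarrow> take j ?as. k - r) + sum_list (take j ?as) = j * k"
      using sum_list_diff_add_sum_list_eq[of "take j ?as" k] small j by simp
    ultimately show ?thesis by linarith
  qed simp
qed

theorem theorem2p3:
  fixes d :: nat and lam mu :: "nat list"
  assumes "d \<ge> 1"
    and "is_partition d lam"
    and "is_partition d mu"
  shows "(\<forall>n \<ge> 1. \<forall>x \<in> nonneg_orthant n.
            power_sum_partition n lam x \<ge> power_sum_partition n mu x)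
         \<longleftrightarrow> lam \<succeq> mu"
proof
  assume "\<forall>n \<ge> 1. \<forall>x \<in> nonneg_orthant n.
    power_sum_partition n lam x \<ge> power_sum_partition n mu x"
  then show "lam \<succeq> mu"
    \<comment> \<open>The dimension \<open>Suc (N ^ k)\<close> is at least 1 for every
      \<open>N\<close>, so the hypothesis covers all test points.\<close>
    by (intro superdominates_if_sum_list_diff_le sum_list_diff_le_if_power_sum_partition_le)
      (simp add: test_point_in_nonneg_orthant)
next
  assume dom: "lam \<succeq> mu"
  have sum: "sum_list lam = d" "sum_list mu = d" and pos: "\<forall>k \<in> set mu. k > 0"
    using assms by (simp_all add: is_partition_def)
  have "lam \<noteq> []" "mu \<noteq> []"
    using sum \<open>d \<ge> 1\<close> by (auto simp del: sum_list_eq_0_iff)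
  then show "\<forall>n \<ge> 1. \<forall>x \<in> nonneg_orthant n.
      power_sum_partition n lam x \<ge> power_sum_partition n mu x"
    using power_sum_partition_le_if_superdominates[OF dom _ pos] sum by simp
qed

end
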